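(* Let $\phi:\mathbb{R}\times\mathbb{R}^n\to\mathbb{R}^m$ be such that $t\mapsto\phi(t,x)$ is locally integrable for each $x$. Then $\phi$ is u$\delta$-PE with respect to $x_1$ if and only if for each $\delta>0$ and $\Delta\ge\delta$ there exist $T>0$ and $\mu>0$ such that, for all $t\in\mathbb{R}$, $$|x_1|\in[\delta,\Delta],\ |x_2|\in[0,\Delta]\quad\Longrightarrow\quad\int_t^{t+T}|\phi(\tau,x)|\,d\tau\ge\mu.$$
   Context: $|\cdot|$ is the Euclidean norm. $x\in\mathbb{R}^n$ is partitioned as $x=\mathrm{col}[x_1,x_2]$ with $x_1\in\mathbb{R}^{n_1}$, $x_2\in\mathbb{R}^{n_2}$, and $\mathcal{D}_1:=(\mathbb{R}^{n_1}\setminus\{0\})\times\mathbb{R}^{n_2}$. $\phi$, with $t\mapsto\phi(t,x)$ locally integrable, is u$\delta$-PE (uniformly $\delta$-persistently exciting) with respect to $x_1$ if for each $x\in\mathcal{D}_1$ there exist $\delta>0$, $T>0$, $\mu>0$ such that for all $t\in\mathbb{R}$: $|z-x|\le\delta$ implies $\int_t^{t+T}|\phi(\tau,z)|\,d\tau\ge\mu$. *)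

theory Defs
  imports "HOL-Analysis.Analysis"
begin

definition locally_integrable :: "(real \<Rightarrow> real ^ 'm) \<Rightarrow> bool" where
  "locally_integrable f \<longleftrightarrow> (\<forall>K. compact K \<longrightarrow> f absolutely_integrable_on K)"

(* The space containing x = col[x1, x2] is the product type real ^ 'n1 \<times> real ^ 'n2;
   its norm is the Euclidean one, sqrt (norm x1 ^ 2 + norm x2 ^ 2). *)

definition D1 :: "((real ^ 'n1) \<times> (real ^ 'n2)) set" where
  "D1 = (UNIV - {0}) \<times> UNIV"

(* Local integrability of the maps t \<mapsto> phi t x is not part of this definition and has to be
   assumed separately; without it the Lebesgue integral below may take the default value 0. *)
definition udelta_PE :: "(real \<Rightarrow> (real ^ 'n1) \<times> (real ^ 'n2) \<Rightarrow> real ^ 'm) \<Rightarrow> bool" where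
  "udelta_PE \<phi> \<longleftrightarrow>
     (\<forall>x\<in>D1. \<exists>\<delta>>0. \<exists>T>0. \<exists>\<mu>>0. \<forall>t. \<forall>z.
        norm (z - x) \<le> \<delta> \<longrightarrow> (LINT \<tau>:{t..t+T}|lebesgue. norm (\<phi> \<tau> z)) \<ge> \<mu>)"

end

theory Submission
  imports Defs
begin

text \<open>
  Both conditions bound the excitation \<open>\<integral>\<^bsub>t\<^esub>\<^bsup>t+T\<^esup> |\<phi>(\<tau>, z)| d\<tau>\<close> from below, uniformly
  in \<open>t\<close>: the first near every point of the open set where \<open>x\<^sub>1 \<noteq> 0\<close>, the second on
  the compact sets given by \<open>\<delta> \<le> |x\<^sub>1| \<le> \<Delta>\<close>, \<open>|x\<^sub>2| \<le> \<Delta>\<close>. These compact sets lie in the open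
  set, and each point of the open set has a closed ball around it that is contained in one of them;
  so the equivalence is the passage between local uniformity and uniformity on compact sets.

  From compact to local, the bound for one compact set restricts to the ball. From local to
  compact, finitely many of the given balls cover the compact set, but each comes
  with its own \<open>T\<close> and \<open>\<mu>\<close>. The largest \<open>T\<close> and the smallest \<open>\<mu>\<close> serve for all of them,
  because the integral of a nonnegative function grows with the window. This growth
  (\<open>excitation_mono\<close>) is where local integrability enters; the covering argument is
  \<open>compact_uniform_lower_bound\<close>.
\<close>

text \<open>
  The Lebesgue integral of a nonintegrable function is \<open>0\<close> by convention, so enlarging the
  window could lower the integral if the function were not integrable on the larger window.
\<close>

lemma excitation_mono:
  fixes f :: "real \<Rightarrow> real ^ 'm"
  assumes "locally_integrable f" "S \<le> T"
  shows "(LINT \<tau>:{t..t+S}|lebesgue. norm (f \<tau>)) \<le> (LINT \<tau>:{t..t+T}|lebesgue. norm (f \<tau>))"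
proof -
  have int: "set_integrable lebesgue {t..t+r} (\<lambda>\<tau>. norm (f \<tau>))" for r
    using assms(1) unfolding locally_integrable_def
    by (auto intro: set_integrable_norm)
  show ?thesis
    unfolding set_lebesgue_integral_def
  proof (rule integral_mono)
    show "integrable lebesgue (\<lambda>\<tau>. indicat_real {t..t+S} \<tau> *\<^sub>R norm (f \<tau>))"
      "integrable lebesgue (\<lambda>\<tau>. indicat_real {t..t+T} \<tau> *\<^sub>R norm (f \<tau>))"
      using int unfolding set_integrable_def by auto
    show "indicat_real {t..t+S} \<tau> *\<^sub>R norm (f \<tau>) \<le> indicat_real {t..t+T} \<tau> *\<^sub>R norm (f \<tau>)" for \<tau>
      using assms(2) by (auto simp: indicator_def)
  qed
qed

text \<open>
  By monotonicity in \<open>T\<close>, enlarging \<open>T\<close> or lowering \<open>\<mu>\<close> keeps a lower bound valid; hence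
  the finitely many pairs \<open>(T, \<mu>)\<close> of a finite subcover can be replaced by a common one.
\<close>

lemma compact_uniform_lower_bound:
  fixes E :: "real \<Rightarrow> 'b \<Rightarrow> 'a::metric_space \<Rightarrow> real"
  assumes "compact K"
    and mono: "\<And>S T t z. S \<le> T \<Longrightarrow> E S t z \<le> E T t z"
    and local: "\<And>x. x \<in> K \<Longrightarrow>
      \<exists>\<delta>>0. \<exists>T>0. \<exists>\<mu>>0. \<forall>t z. dist z x \<le> \<delta> \<longrightarrow> \<mu> \<le> E T t z"
  shows "\<exists>T>0. \<exists>\<mu>>0. \<forall>t. \<forall>z\<in>K. \<mu> \<le> E T t z"
proof -
  obtain \<delta> T \<mu> where pos: "\<And>x. x \<in> K \<Longrightarrow> \<delta> x > 0 \<and> T x > (0::real) \<and> \<mu> x > (0::real)"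
    and bound: "\<And>x t z. \<lbrakk>x \<in> K; dist z x \<le> \<delta> x\<rbrakk> \<Longrightarrow> \<mu> x \<le> E (T x) t z"
    using local by metis
  obtain C where C: "C \<subseteq> K" "finite C" "K \<subseteq> (\<Union>x\<in>C. ball x (\<delta> x))"
    by (rule compactE_image[OF \<open>compact K\<close>, of K "\<lambda>x. ball x (\<delta> x)"]) (use pos in auto)
  \<comment> \<open>Inserting \<open>1\<close> keeps the maximum and the minimum meaningful when \<open>K\<close> is empty.\<close>
  let ?T = "Max (insert 1 (T ` C))" and ?\<mu> = "Min (insert 1 (\<mu> ` C))"
  have "?T > 0"
    using C(2) by (simp add: Max_gr_iff)
  moreover have "?\<mu> > 0"
    using C pos by auto
  moreover have "?\<mu> \<le> E ?T t z" if "z \<in> K" for t z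
  proof -
    obtain x where x: "x \<in> C" "dist z x \<le> \<delta> x"
      using C(3) \<open>z \<in> K\<close> by (force simp: dist_commute)
    have "?\<mu> \<le> \<mu> x"
      using C(2) x(1) by simp
    also have "\<mu> x \<le> E (T x) t z"
      using bound C(1) x by blast
    also have "\<dots> \<le> E ?T t z"
      using C(2) x(1) by (intro mono) simp
    finally show ?thesis .
  qed
  ultimately show ?thesis
    by blast
qed

theorem lemma2:
  fixes \<phi> :: "real \<Rightarrow> (real ^ 'n1) \<times> (real ^ 'n2) \<Rightarrow> real ^ 'm"
  assumes "\<And>x. locally_integrable (\<lambda>t. \<phi> t x)"
  shows "udelta_PE \<phi> \<longleftrightarrow>
    (\<forall>\<delta>>0. \<forall>\<Delta>\<ge>\<delta>. \<exists>T>0. \<exists>\<mu>>0. \<forall>t. \<forall>x1 x2.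
       norm x1 \<in> {\<delta>..\<Delta>} \<and> norm x2 \<in> {0..\<Delta>} \<longrightarrow>
         (LINT \<tau>:{t..t+T}|lebesgue. norm (\<phi> \<tau> (x1, x2))) \<ge> \<mu>)"
    (is "_ \<longleftrightarrow> ?uniform")
proof
  define E where "E T t z = (LINT \<tau>:{t..t+T}|lebesgue. norm (\<phi> \<tau> z))" for T t z
  assume PE: "udelta_PE \<phi>"
  show ?uniform
  proof (intro allI impI)
    fix \<delta> \<Delta> :: real
    assume "\<delta> > 0" "\<delta> \<le> \<Delta>"
    define K where "K = (cball 0 \<Delta> - ball 0 \<delta> :: (real ^ 'n1) set) \<times> (cball 0 \<Delta> :: (real ^ 'n2) set)"
    have "compact K"
      unfolding K_def by (intro compact_Times compact_diff) auto
    moreover have "E S t z \<le> E T t z" if "S \<le> T" for S T t z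
      unfolding E_def using assms that by (rule excitation_mono)
    moreover have "\<exists>\<delta>>0. \<exists>T>0. \<exists>\<mu>>0. \<forall>t z. dist z x \<le> \<delta> \<longrightarrow> \<mu> \<le> E T t z" if "x \<in> K" for x
    proof -
      have "x \<in> D1"
        using that \<open>\<delta> > 0\<close> by (auto simp: K_def D1_def)
      then show ?thesis
        using PE unfolding udelta_PE_def E_def dist_norm by blast
    qed
    ultimately have "\<exists>T>0. \<exists>\<mu>>0. \<forall>t. \<forall>z\<in>K. \<mu> \<le> E T t z"
      by (rule compact_uniform_lower_bound)
    then show "\<exists>T>0. \<exists>\<mu>>0. \<forall>t. \<forall>x1 x2.
        norm x1 \<in> {\<delta>..\<Delta>} \<and> norm x2 \<in> {0..\<Delta>} \<longrightarrow>
          (LINT \<tau>:{t..t+T}|lebesgue. norm (\<phi> \<tau> (x1, x2))) \<ge> \<mu>"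
      by (force simp: K_def E_def)
  qed
next
  assume uniform: ?uniform
  show "udelta_PE \<phi>"
    unfolding udelta_PE_def
  proof
    fix x :: "(real ^ 'n1) \<times> (real ^ 'n2)"
    assume "x \<in> D1"
    \<comment> \<open>Half the distance to the excluded set \<open>x\<^sub>1 = 0\<close>: it is both the radius of the ball and
      a lower bound for \<open>|z\<^sub>1|\<close> on that ball.\<close>
    define d where "d = norm (fst x) / 2"
    define \<Delta> where "\<Delta> = 3 * d + norm (snd x)"
    have "d > 0"
      using \<open>x \<in> D1\<close> by (auto simp: D1_def d_def)
    moreover from this have "d \<le> \<Delta>"
      unfolding \<Delta>_def using norm_ge_zero[of "snd x"] by linarith
    ultimately obtain T \<mu> where "T > 0" "\<mu> > 0"
      and bound: "\<And>t x1 x2. \<lbrakk>norm x1 \<in> {d..\<Delta>}; norm x2 \<in> {0..\<Delta>}\<rbrakk> \<Longrightarrow>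
        (LINT \<tau>:{t..t+T}|lebesgue. norm (\<phi> \<tau> (x1, x2))) \<ge> \<mu>"
      using uniform by meson
    have "(LINT \<tau>:{t..t+T}|lebesgue. norm (\<phi> \<tau> z)) \<ge> \<mu>" if "norm (z - x) \<le> d" for t z
    proof -
      have "norm (fst z - fst x) \<le> d" "norm (snd z - snd x) \<le> d"
        using that norm_fst_le norm_snd_le
        by (metis fst_diff order_trans prod.collapse, metis order_trans prod.collapse snd_diff)
      then have "\<bar>norm (fst z) - norm (fst x)\<bar> \<le> d" "\<bar>norm (snd z) - norm (snd x)\<bar> \<le> d"
        using norm_triangle_ineq3 order_trans by blast+
      moreover have "norm (fst x) = 2 * d"
        by (simp add: d_def)
      ultimately have "norm (fst z) \<in> {d..\<Delta>}" "norm (snd z) \<in> {0..\<Delta>}"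
        using \<open>d > 0\<close> norm_ge_zero[of "snd x"] norm_ge_zero[of "snd z"]
        unfolding \<Delta>_def atLeastAtMost_iff by linarith+
      from bound[OF this, of t] show ?thesis
        by simp
    qed
    then show "\<exists>\<delta>>0. \<exists>T>0. \<exists>\<mu>>0. \<forall>t. \<forall>z.
        norm (z - x) \<le> \<delta> \<longrightarrow> (LINT \<tau>:{t..t+T}|lebesgue. norm (\<phi> \<tau> z)) \<ge> \<mu>"
      using \<open>d > 0\<close> \<open>T > 0\<close> \<open>\<mu> > 0\<close> by blast
  qed
qed

end
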